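(* Let $\mathcal{M}_1,\mathcal{M}_2$ be locally finite structures in languages $\mathcal{L}_1,\mathcal{L}_2$, respectively, with the same domain $M$. Assume that for all (same-length, finite) tuples $\bar a,\bar b$ from $M$, $\mathrm{qftp}_{\mathcal{M}_1}(\bar a)=\mathrm{qftp}_{\mathcal{M}_1}(\bar b)$ if, and only if, $\mathrm{qftp}_{\mathcal{M}_2}(\bar a)=\mathrm{qftp}_{\mathcal{M}_2}(\bar b)$. Then $\mathcal{M}_1$ has the embedding Ramsey property if, and only if, $\mathcal{M}_2$ has the embedding Ramsey property.
   Context: A structure is locally finite if every finite subset generates a finite substructure. $\mathrm{qftp}$ denotes complete quantifier-free type over $\emptyset$. $\mathrm{Age}(\mathcal{M})$ is the class of (isomorphism types of) finitely generated substructures of $\mathcal{M}$. For structures $A,C$, $\binom{C}{A}$ is the set of embeddings $A\to C$. For $A\subseteq B$, write $C\to(B)^A_2$ if for every $\chi:\binom{C}{A}\to\{0,1\}$ there is an embedding $e:B\to C$ such that $\chi$ is constant on $\{e\circ f:f\in\binom{B}{A}\}$. A structure $\mathcal{M}$ has the embedding Ramsey property if for all $A\subseteq B$ in $\mathrm{Age}(\mathcal{M})$ there is $C\in\mathrm{Age}(\mathcal{M})$ with $C\to(B)^A_2$. *)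

theory Defs
  imports "HOL-Library.FuncSet"
begin

section \<open>Languages and structures\<close>

text \<open>Symbols are given by sets, so that a language may have no function symbols or no
  relation symbols. Constants are function symbols of arity 0.\<close>

record ('f, 'r) lang =
  funs :: "'f set"
  rels :: "'r set"
  farity :: "'f \<Rightarrow> nat"
  rarity :: "'r \<Rightarrow> nat"

text \<open>The interpretations are total HOL functions; only their values on symbols of the
  language and on tuples from the domain of the right length are meaningful, and nothing
  below depends on the other values. The domain may be empty.\<close>

record ('f, 'r, 'a) struct =
  univ :: "'a set"
  fint :: "'f \<Rightarrow> 'a list \<Rightarrow> 'a"
  rint :: "'r \<Rightarrow> 'a list \<Rightarrow> bool"

definition tuples :: "'a set \<Rightarrow> nat \<Rightarrow> 'a list set" where
  "tuples S n = {xs. set xs \<subseteq> S \<and> length xs = n}"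

definition closed_under :: "('f, 'r) lang \<Rightarrow> ('f, 'r, 'a) struct \<Rightarrow> 'a set \<Rightarrow> bool" where
  "closed_under L \<M> S \<longleftrightarrow> (\<forall>f\<in>funs L. \<forall>xs\<in>tuples S (farity L f). fint \<M> f xs \<in> S)"

definition is_struct :: "('f, 'r) lang \<Rightarrow> ('f, 'r, 'a) struct \<Rightarrow> bool" where
  "is_struct L \<M> \<longleftrightarrow> closed_under L \<M> (univ \<M>)"

definition substructure ::
  "('f, 'r) lang \<Rightarrow> ('f, 'r, 'a) struct \<Rightarrow> ('f, 'r, 'a) struct \<Rightarrow> bool" where
  "substructure L A B \<longleftrightarrow>
     is_struct L A \<and> is_struct L B \<and> univ A \<subseteq> univ B \<and>
     (\<forall>f\<in>funs L. \<forall>xs\<in>tuples (univ A) (farity L f). fint A f xs = fint B f xs) \<and>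
     (\<forall>r\<in>rels L. \<forall>xs\<in>tuples (univ A) (rarity L r). rint A r xs \<longleftrightarrow> rint B r xs)"

definition generated :: "('f, 'r) lang \<Rightarrow> ('f, 'r, 'a) struct \<Rightarrow> 'a set \<Rightarrow> ('f, 'r, 'a) struct" where
  "generated L \<M> X =
     \<M>\<lparr>univ := \<Inter>{S. X \<subseteq> S \<and> S \<subseteq> univ \<M> \<and> closed_under L \<M> S}\<rparr>"

definition finitely_generated :: "('f, 'r) lang \<Rightarrow> ('f, 'r, 'a) struct \<Rightarrow> bool" where
  "finitely_generated L A \<longleftrightarrow>
     (\<exists>X. finite X \<and> X \<subseteq> univ A \<and> univ (generated L A X) = univ A)"

definition locally_finite :: "('f, 'r) lang \<Rightarrow> ('f, 'r, 'a) struct \<Rightarrow> bool" where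
  "locally_finite L \<M> \<longleftrightarrow>
     (\<forall>X. finite X \<and> X \<subseteq> univ \<M> \<longrightarrow> finite (univ (generated L \<M> X)))"


section \<open>Quantifier-free types\<close>

datatype 'f trm = Var nat | App 'f "'f trm list"

datatype ('f, 'r) qf_fm =
    Falsum
  | Eql "'f trm" "'f trm"
  | Rel 'r "'f trm list"
  | Neg "('f, 'r) qf_fm"
  | Conj "('f, 'r) qf_fm" "('f, 'r) qf_fm"

text \<open>Well-formedness over a language, with variables among \<open>Var 0, \<dots>, Var (n - 1)\<close>.\<close>

fun wf_trm :: "('f, 'r) lang \<Rightarrow> nat \<Rightarrow> 'f trm \<Rightarrow> bool" where
  "wf_trm L n (Var i) \<longleftrightarrow> i < n"
| "wf_trm L n (App f ts) \<longleftrightarrow>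
     f \<in> funs L \<and> length ts = farity L f \<and> (\<forall>t\<in>set ts. wf_trm L n t)"

fun wf_fm :: "('f, 'r) lang \<Rightarrow> nat \<Rightarrow> ('f, 'r) qf_fm \<Rightarrow> bool" where
  "wf_fm L n Falsum \<longleftrightarrow> True"
| "wf_fm L n (Eql s t) \<longleftrightarrow> wf_trm L n s \<and> wf_trm L n t"
| "wf_fm L n (Rel r ts) \<longleftrightarrow>
     r \<in> rels L \<and> length ts = rarity L r \<and> (\<forall>t\<in>set ts. wf_trm L n t)"
| "wf_fm L n (Neg \<phi>) \<longleftrightarrow> wf_fm L n \<phi>"
| "wf_fm L n (Conj \<phi> \<psi>) \<longleftrightarrow> wf_fm L n \<phi> \<and> wf_fm L n \<psi>"

fun eval_trm :: "('f, 'r, 'a) struct \<Rightarrow> 'a list \<Rightarrow> 'f trm \<Rightarrow> 'a" where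
  "eval_trm \<M> xs (Var i) = xs ! i"
| "eval_trm \<M> xs (App f ts) = fint \<M> f (map (eval_trm \<M> xs) ts)"

fun sat :: "('f, 'r, 'a) struct \<Rightarrow> 'a list \<Rightarrow> ('f, 'r) qf_fm \<Rightarrow> bool" where
  "sat \<M> xs Falsum \<longleftrightarrow> False"
| "sat \<M> xs (Eql s t) \<longleftrightarrow> eval_trm \<M> xs s = eval_trm \<M> xs t"
| "sat \<M> xs (Rel r ts) \<longleftrightarrow> rint \<M> r (map (eval_trm \<M> xs) ts)"
| "sat \<M> xs (Neg \<phi>) \<longleftrightarrow> \<not> sat \<M> xs \<phi>"
| "sat \<M> xs (Conj \<phi> \<psi>) \<longleftrightarrow> sat \<M> xs \<phi> \<and> sat \<M> xs \<psi>"

definition qftp :: "('f, 'r) lang \<Rightarrow> ('f, 'r, 'a) struct \<Rightarrow> 'a list \<Rightarrow> ('f, 'r) qf_fm set" where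
  "qftp L \<M> xs = {\<phi>. wf_fm L (length xs) \<phi> \<and> sat \<M> xs \<phi>}"


section \<open>Embeddings, age and the embedding Ramsey property\<close>

text \<open>Embeddings are extensional functions (\<open>undefined\<close> outside the domain of the source), so
  that they correspond exactly to maps between the domains. Consequently they are composed
  with \<^const>\<open>compose\<close>.\<close>

definition embeddings ::
  "('f, 'r) lang \<Rightarrow> ('f, 'r, 'a) struct \<Rightarrow> ('f, 'r, 'b) struct \<Rightarrow> ('a \<Rightarrow> 'b) set" where
  "embeddings L A B =
     {e \<in> univ A \<rightarrow>\<^sub>E univ B. inj_on e (univ A) \<and>
        (\<forall>f\<in>funs L. \<forall>xs\<in>tuples (univ A) (farity L f). e (fint A f xs) = fint B f (map e xs)) \<and>
        (\<forall>r\<in>rels L. \<forall>xs\<in>tuples (univ A) (rarity L r). rint A r xs \<longleftrightarrow> rint B r (map e xs))}"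

definition isomorphic ::
  "('f, 'r) lang \<Rightarrow> ('f, 'r, 'a) struct \<Rightarrow> ('f, 'r, 'b) struct \<Rightarrow> bool" where
  "isomorphic L A B \<longleftrightarrow> (\<exists>e\<in>embeddings L A B. e ` univ A = univ B)"

text \<open>Isomorphism types are rendered by closing the finitely generated substructures under
  isomorphism. All members live on the same HOL type as \<open>\<M>\<close>; this type contains
  representatives of all isomorphism types in question, namely the finitely generated
  substructures of \<open>\<M>\<close> themselves.\<close>

definition Age :: "('f, 'r) lang \<Rightarrow> ('f, 'r, 'a) struct \<Rightarrow> ('f, 'r, 'a) struct set" where
  "Age L \<M> = {A. is_struct L A \<and>
     (\<exists>N. substructure L N \<M> \<and> finitely_generated L N \<and> isomorphic L A N)}"

text \<open>\<open>arrows L C B A\<close> is the partition relation \<open>C \<rightarrow> (B)\<close> with superscript \<open>A\<close> and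
  subscript 2 (two colours).\<close>

definition arrows ::
  "('f, 'r) lang \<Rightarrow> ('f, 'r, 'c) struct \<Rightarrow> ('f, 'r, 'b) struct \<Rightarrow> ('f, 'r, 'a) struct \<Rightarrow> bool" where
  "arrows L C B A \<longleftrightarrow>
     (\<forall>\<chi> \<in> embeddings L A C \<rightarrow> {0, 1 :: nat}.
        \<exists>e\<in>embeddings L B C. \<exists>c. \<forall>g\<in>{compose (univ A) e f |f. f \<in> embeddings L A B}. \<chi> g = c)"

definition embedding_Ramsey :: "('f, 'r) lang \<Rightarrow> ('f, 'r, 'a) struct \<Rightarrow> bool" where
  "embedding_Ramsey L \<M> \<longleftrightarrow>
     (\<forall>A\<in>Age L \<M>. \<forall>B\<in>Age L \<M>. substructure L A B \<longrightarrow>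
        (\<exists>C\<in>Age L \<M>. arrows L C B A))"

end

theory Submission
  imports Defs
begin

text \<open>An injection from one structure to another is an embedding iff it preserves quantifier-free
  types of tuples, so the embeddings between finite subsets of \<open>M\<close> can be transported between the
  two languages. Generated substructures may differ (a constant can be traded for a unary
  predicate), so given \<open>A \<subseteq> B\<close> in the age of \<open>\<M>2\<close>, realised in \<open>M\<close>, one applies the Ramsey property
  to the substructures of \<open>\<M>1\<close> that they generate; these are finite, and so is the resulting \<open>C\<close>,
  which generates a finitely generated substructure of \<open>\<M>2\<close>. A colouring of the copies of \<open>A\<close> in the
  latter is pulled back by restricting embeddings of the generated structure to \<open>A\<close>, and every
  embedding \<open>A \<rightarrow> B\<close> extends to the generated structures because the terms of a tuple are
  controlled by its type.\<close>

section \<open>Embeddings and quantifier-free types\<close>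

lemma wf_eval_trm_in_closed:
  assumes "closed_under L \<M> S" "set xs \<subseteq> S" "wf_trm L (length xs) t"
  shows "eval_trm \<M> xs t \<in> S"
  using assms(3)
proof (induction t)
  case (Var i)
  then show ?case using assms(2) by (auto simp: subset_iff)
next
  case (App f ts)
  then have "map (eval_trm \<M> xs) ts \<in> tuples S (farity L f)"
    by (auto simp: tuples_def)
  then show ?case using App assms(1) by (auto simp: closed_under_def)
qed

lemma embeddings_eval_trm:
  assumes "e \<in> embeddings L A B" "is_struct L A" "set xs \<subseteq> univ A" "wf_trm L (length xs) t"
  shows "eval_trm B (map e xs) t = e (eval_trm A xs t)"
  using assms(4)
proof (induction t)
  case (App f ts)
  have "map (eval_trm A xs) ts \<in> tuples (univ A) (farity L f)"
    using App.prems assms(2,3) wf_eval_trm_in_closed[of L A "univ A" xs]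
    by (auto simp: tuples_def is_struct_def)
  moreover have "map (eval_trm B (map e xs)) ts = map e (map (eval_trm A xs) ts)"
    using App by auto
  ultimately show ?case using App.prems assms(1) by (simp add: embeddings_def del: map_map)
qed (use assms in auto)

lemma embeddings_sat:
  assumes "e \<in> embeddings L A B" "is_struct L A" "set xs \<subseteq> univ A" "wf_fm L (length xs) \<phi>"
  shows "sat B (map e xs) \<phi> \<longleftrightarrow> sat A xs \<phi>"
  using assms(4)
proof (induction \<phi>)
  case (Eql s t)
  then have "eval_trm A xs s \<in> univ A" "eval_trm A xs t \<in> univ A"
    using assms(2,3) wf_eval_trm_in_closed[of L A "univ A" xs] by (auto simp: is_struct_def)
  moreover have "inj_on e (univ A)" using assms(1) by (simp add: embeddings_def)
  ultimately show ?case
    using Eql embeddings_eval_trm[OF assms(1-3)] by (simp add: inj_on_eq_iff)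
next
  case (Rel r ts)
  have "map (eval_trm A xs) ts \<in> tuples (univ A) (rarity L r)"
    using Rel assms(2,3) wf_eval_trm_in_closed[of L A "univ A" xs]
    by (auto simp: tuples_def is_struct_def)
  moreover have "map (eval_trm B (map e xs)) ts = map e (map (eval_trm A xs) ts)"
    using Rel embeddings_eval_trm[OF assms(1-3)] by auto
  ultimately show ?case using Rel assms(1) by (simp add: embeddings_def del: map_map)
qed auto

lemma qftp_eq_eval_trm_eq_iff:
  assumes "qftp L A xs = qftp L B ys" "length xs = length ys"
    "wf_trm L (length xs) s" "wf_trm L (length xs) t"
  shows "eval_trm A xs s = eval_trm A xs t \<longleftrightarrow> eval_trm B ys s = eval_trm B ys t"
proof -
  have "Eql s t \<in> qftp L A xs \<longleftrightarrow> Eql s t \<in> qftp L B ys" using assms by simp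
  then show ?thesis using assms by (simp add: qftp_def)
qed

lemma qftp_eq_rint_iff:
  assumes "qftp L A xs = qftp L B ys" "length xs = length ys"
    "r \<in> rels L" "length ts = rarity L r" "\<And>t. t \<in> set ts \<Longrightarrow> wf_trm L (length xs) t"
  shows "rint A r (map (eval_trm A xs) ts) \<longleftrightarrow> rint B r (map (eval_trm B ys) ts)"
proof -
  have "Rel r ts \<in> qftp L A xs \<longleftrightarrow> Rel r ts \<in> qftp L B ys" using assms by simp
  then show ?thesis using assms by (simp add: qftp_def)
qed

text \<open>Applying a symbol to the list of variables thus speaks about \<open>xs\<close> itself;
  the tail \<open>zs\<close> leaves room for a variable naming a function value.\<close>

lemma map_eval_trm_Vars: "map (eval_trm A (xs @ zs)) (map Var [0..<length xs]) = xs"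
  by (rule nth_equalityI) (auto simp: nth_append)

text \<open>Embeddings preserve all quantifier-free formulas; conversely, injectivity and
  preservation of each symbol are single formulas about finite tuples. The right-hand side mentions
  the language only through \<open>qftp\<close>, so it can be moved between languages.\<close>

lemma embeddings_iff_qftp:
  assumes "is_struct L A"
  shows "e \<in> embeddings L A B \<longleftrightarrow> e \<in> univ A \<rightarrow>\<^sub>E univ B \<and>
    (\<forall>xs. set xs \<subseteq> univ A \<longrightarrow> qftp L B (map e xs) = qftp L A xs)"
proof (intro iffI conjI allI impI)
  fix xs assume "e \<in> embeddings L A B" "set xs \<subseteq> univ A"
  then show "qftp L B (map e xs) = qftp L A xs"
    using embeddings_sat[of e L A B xs] assms by (auto simp: qftp_def)
next
  assume "e \<in> embeddings L A B"
  then show "e \<in> univ A \<rightarrow>\<^sub>E univ B" by (simp add: embeddings_def)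
next
  assume *: "e \<in> univ A \<rightarrow>\<^sub>E univ B \<and>
    (\<forall>xs. set xs \<subseteq> univ A \<longrightarrow> qftp L B (map e xs) = qftp L A xs)"
  then have tp: "qftp L A xs = qftp L B (map e xs)" if "set xs \<subseteq> univ A" for xs
    using that by simp
  \<comment> \<open>Injectivity is the formula \<open>Eql (Var 0) (Var 1)\<close> in the type of
    \<open>[x, y]\<close>.\<close>
  have "x = y" if "x \<in> univ A" "y \<in> univ A" "e x = e y" for x y
    using qftp_eq_eval_trm_eq_iff[OF tp, of "[x, y]" "Var 0" "Var 1"] that by simp
  then have "inj_on e (univ A)" by (rule inj_onI)
  moreover have "e (fint A f xs) = fint B f (map e xs)"
    if f: "f \<in> funs L" and xs: "xs \<in> tuples (univ A) (farity L f)" for f xs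
  proof -
    \<comment> \<open>Appending \<open>?y\<close> gives it the variable of index
      \<open>length xs\<close>, so that f(xs) = y is a formula in the type of
      \<open>xs @ [?y]\<close>.\<close>
    let ?y = "fint A f xs" and ?ts = "map Var [0..<length xs]"
    have "?y \<in> univ A" using assms f xs by (auto simp: is_struct_def closed_under_def)
    then have "eval_trm A (xs @ [?y]) (App f ?ts) = eval_trm A (xs @ [?y]) (Var (length xs)) \<longleftrightarrow>
        eval_trm B (map e (xs @ [?y])) (App f ?ts) =
          eval_trm B (map e (xs @ [?y])) (Var (length xs))"
      using f xs by (intro qftp_eq_eval_trm_eq_iff[OF tp]) (auto simp: tuples_def)
    then show ?thesis
      using map_eval_trm_Vars[of A xs "[?y]"] map_eval_trm_Vars[of B "map e xs" "[e ?y]"]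
      by (simp add: nth_append del: map_map)
  qed
  moreover have "rint A r xs \<longleftrightarrow> rint B r (map e xs)"
    if r: "r \<in> rels L" and xs: "xs \<in> tuples (univ A) (rarity L r)" for r xs
  proof -
    let ?ts = "map Var [0..<length xs]"
    have "rint A r (map (eval_trm A xs) ?ts) \<longleftrightarrow> rint B r (map (eval_trm B (map e xs)) ?ts)"
      using r xs by (intro qftp_eq_rint_iff[OF tp]) (auto simp: tuples_def)
    then show ?thesis
      using map_eval_trm_Vars[of A xs "[]"] map_eval_trm_Vars[of B "map e xs" "[]"]
      by (simp del: map_map)
  qed
  ultimately show "e \<in> embeddings L A B" using * by (simp add: embeddings_def)
qed

lemma embeddings_subset_substructure:
  assumes "substructure L A B" "e \<in> embeddings L B C"
  shows "restrict e (univ A) \<in> embeddings L A C"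
proof -
  have sub: "univ A \<subseteq> univ B" and A: "is_struct L A"
    using assms(1) by (auto simp: substructure_def)
  \<comment> \<open>On tuples from \<open>A\<close> the restriction agrees with \<open>e\<close>.
    Outside \<open>univ A\<close> it is \<open>undefined\<close>, so function values must be shown
    to lie in \<open>univ A\<close>.\<close>
  have map: "map (restrict e (univ A)) xs = map e xs" "xs \<in> tuples (univ B) n"
    if "xs \<in> tuples (univ A) n" for xs n
    using that sub by (auto simp: tuples_def subset_iff)
  have e: "e \<in> univ B \<rightarrow>\<^sub>E univ C" "inj_on e (univ B)"
    using assms(2) by (simp_all add: embeddings_def)
  have "restrict e (univ A) \<in> univ A \<rightarrow>\<^sub>E univ C" using e(1) sub by auto
  moreover have "inj_on (restrict e (univ A)) (univ A)"
    using e(2) sub by (simp add: inj_on_subset)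
  moreover have "restrict e (univ A) (fint A f xs) = fint C f (map (restrict e (univ A)) xs)"
    if "f \<in> funs L" "xs \<in> tuples (univ A) (farity L f)" for f xs
  proof -
    have "fint A f xs \<in> univ A" using A that by (simp add: is_struct_def closed_under_def)
    then show ?thesis
      using assms that map[OF that(2)]
      by (simp add: embeddings_def substructure_def del: map_eq_conv)
  qed
  moreover have "rint A r xs \<longleftrightarrow> rint C r (map (restrict e (univ A)) xs)"
    if "r \<in> rels L" "xs \<in> tuples (univ A) (rarity L r)" for r xs
    using assms that map[OF that(2)]
      by (simp add: embeddings_def substructure_def del: map_eq_conv)
  ultimately show ?thesis unfolding embeddings_def by blast
qed

section \<open>Generated substructures and the age\<close>

lemma generated_simps [simp]:
  "fint (generated L \<M> X) = fint \<M>"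
  "rint (generated L \<M> X) = rint \<M>"
  by (simp_all add: generated_def)

lemma eval_trm_generated [simp]: "eval_trm (generated L \<M> X) xs t = eval_trm \<M> xs t"
  by (induction t) (auto cong: map_cong)

lemma sat_generated [simp]: "sat (generated L \<M> X) xs \<phi> \<longleftrightarrow> sat \<M> xs \<phi>"
proof (induction \<phi>)
  case (Rel r ts)
  have "map (eval_trm (generated L \<M> X) xs) ts = map (eval_trm \<M> xs) ts" by simp
  then show ?case by (simp del: map_eq_conv)
qed auto

lemma qftp_generated [simp]: "qftp L (generated L' \<M> X) xs = qftp L \<M> xs"
  by (simp add: qftp_def)

lemma subset_univ_generated: "X \<subseteq> univ (generated L \<M> X)"
  by (auto simp: generated_def)

lemma univ_generated_subset:
  assumes "closed_under L \<M> S" "X \<subseteq> S" "S \<subseteq> univ \<M>"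
  shows "univ (generated L \<M> X) \<subseteq> S"
  using assms by (auto simp: generated_def)

lemma univ_generated_mono: "X \<subseteq> Y \<Longrightarrow> univ (generated L \<M> X) \<subseteq> univ (generated L \<M> Y)"
  by (auto simp: generated_def)

text \<open>An intersection of closed sets is closed; this covers the empty family, whose
  intersection is \<open>UNIV\<close>.\<close>

lemma closed_under_generated: "closed_under L \<M> (univ (generated L \<M> X))"
  unfolding closed_under_def generated_def tuples_def by simp blast

lemma is_struct_generated: "is_struct L (generated L \<M> X)"
  using closed_under_generated[of L \<M> X] by (simp add: is_struct_def closed_under_def)

lemma substructure_generated:
  assumes "is_struct L \<M>" "X \<subseteq> univ \<M>"
  shows "substructure L (generated L \<M> X) \<M>"
  using assms univ_generated_subset[of L \<M> "univ \<M>" X] is_struct_generated[of L \<M> X]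
  by (simp add: substructure_def is_struct_def)

lemma substructure_generated_mono:
  "X \<subseteq> Y \<Longrightarrow> substructure L (generated L \<M> X) (generated L \<M> Y)"
  using univ_generated_mono[of X Y L \<M>] by (simp add: substructure_def is_struct_generated)

lemma generated_in_Age:
  assumes "is_struct L \<M>" "finite X" "X \<subseteq> univ \<M>"
  shows "generated L \<M> X \<in> Age L \<M>"
proof -
  let ?N = "generated L \<M> X"
  \<comment> \<open>\<open>X\<close> generates \<open>?N\<close> from within: a subset closed in
    \<open>?N\<close> is closed in \<open>\<M>\<close>, as the interpretations coincide, so if it
    contains \<open>X\<close> it takes part in the intersection defining \<open>?N\<close>.\<close>
  have "univ ?N \<subseteq> univ (generated L ?N X)"
  proof
    fix x assume x: "x \<in> univ ?N"
    have "x \<in> S" if "X \<subseteq> S" "S \<subseteq> univ ?N" "closed_under L ?N S" for S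
    proof -
      have "S \<subseteq> univ \<M>" using that substructure_generated[OF assms(1,3)]
        by (auto simp: substructure_def)
      moreover have "closed_under L \<M> S" using that by (simp add: closed_under_def)
      ultimately show ?thesis using univ_generated_subset[of L \<M> S X] that x by blast
    qed
    then show "x \<in> univ (generated L ?N X)" by (auto simp: generated_def[of L ?N])
  qed
  moreover have "univ (generated L ?N X) \<subseteq> univ ?N"
    using subset_univ_generated[of X L \<M>] is_struct_generated[of L \<M> X]
      univ_generated_subset[of L ?N "univ ?N" X]
    by (simp add: is_struct_def)
  ultimately have "finitely_generated L ?N"
    using assms(2) subset_univ_generated[of X L \<M>] unfolding finitely_generated_def by blast
  moreover have "restrict (\<lambda>x. x) (univ ?N) \<in> embeddings L ?N ?N"
  proof -
    have "map (restrict (\<lambda>x. x) (univ ?N)) xs = xs" if "set xs \<subseteq> univ ?N" for xs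
      using that by (intro map_idI) auto
    then show ?thesis by (subst embeddings_iff_qftp[OF is_struct_generated]) simp
  qed
  then have "isomorphic L ?N ?N" unfolding isomorphic_def by (rule bexI[rotated]) auto
  ultimately show ?thesis
    using substructure_generated[OF assms(1,3)] is_struct_generated by (auto simp: Age_def)
qed

text \<open>Supplies a concrete copy inside \<open>\<M>\<close> of a member of the age. Finitely
  generated substructures are finite by local finiteness, and isomorphic copies inherit
  this.\<close>

lemma locally_finite_Age:
  assumes "locally_finite L \<M>" "C \<in> Age L \<M>"
  obtains \<gamma> where "is_struct L C" "finite (univ C)" "\<gamma> \<in> embeddings L C \<M>"
proof -
  obtain N e where C: "is_struct L C" and N: "substructure L N \<M>" "finitely_generated L N"
    and e: "e \<in> embeddings L C N" "e ` univ C = univ N"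
    using assms(2) by (auto simp: Age_def isomorphic_def)
  obtain X where X: "finite X" "X \<subseteq> univ N" "univ (generated L N X) = univ N"
    using N(2) by (auto simp: finitely_generated_def)
  have NM: "univ N \<subseteq> univ \<M>" using N(1) by (simp add: substructure_def)
  \<comment> \<open>\<open>N\<close> need agree with \<open>\<M>\<close> only on tuples from
    \<open>univ N\<close>, so generation in \<open>N\<close> and in \<open>\<M>\<close> is compared
    through \<open>?S\<close>. It is closed in \<open>N\<close> and contains \<open>X\<close>, hence
    is all of \<open>univ N\<close>, which therefore lies in a finite set.\<close>
  let ?S = "univ N \<inter> univ (generated L \<M> X)"
  have "closed_under L N ?S"
    unfolding closed_under_def
  proof (intro ballI)
    fix f xs assume f: "f \<in> funs L" and xs: "xs \<in> tuples ?S (farity L f)"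
    then have "xs \<in> tuples (univ N) (farity L f)"
        "xs \<in> tuples (univ (generated L \<M> X)) (farity L f)"
      by (auto simp: tuples_def)
    then show "fint N f xs \<in> ?S"
      using N(1) f closed_under_generated[of L \<M> X]
      by (auto simp: substructure_def is_struct_def closed_under_def)
  qed
  then have "univ N \<subseteq> ?S"
    using univ_generated_subset[of L N ?S X] X subset_univ_generated[of X L \<M>] by simp
  moreover have "finite (univ (generated L \<M> X))"
    using assms(1) X NM by (auto simp: locally_finite_def)
  ultimately have "finite (univ N)" using finite_subset by blast
  moreover have "inj_on e (univ C)" using e by (simp add: embeddings_def)
  ultimately have "finite (univ C)" using e(2) finite_imageD by metis
  moreover have "e \<in> embeddings L C \<M>"
  proof -
    have img: "map e xs \<in> tuples (univ N) n" if "xs \<in> tuples (univ C) n" for xs n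
      using that e(2) by (auto simp: tuples_def)
    show ?thesis
      using e(1) N(1) NM img by (auto 0 3 simp: embeddings_def substructure_def PiE_iff)
  qed
  ultimately show thesis using that C by blast
qed

section \<open>Generated substructures as sets of term values\<close>

lemma univ_generated_eq_eval_trm:
  assumes "is_struct L \<M>" "set xs \<subseteq> univ \<M>"
  shows "univ (generated L \<M> (set xs)) = eval_trm \<M> xs ` {t. wf_trm L (length xs) t}"
    (is "_ = ?T")
proof
  have "closed_under L \<M> ?T"
    unfolding closed_under_def
  proof (intro ballI)
    fix f ys assume f: "f \<in> funs L" and ys: "ys \<in> tuples ?T (farity L f)"
    \<comment> \<open>Collecting terms that name the entries of \<open>ys\<close> in a list
      \<open>ts\<close> makes \<open>App f ts\<close> a name for
      \<open>fint \<M> f ys\<close>.\<close>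
    then have "ys \<in> lists ?T" by (auto simp: tuples_def)
    then obtain ts where ts: "ys = map (eval_trm \<M> xs) ts" "set ts \<subseteq> {t. wf_trm L (length xs) t}"
      by (auto simp: lists_image image_iff in_lists_conv_set)
    then have "fint \<M> f ys = eval_trm \<M> xs (App f ts)" "wf_trm L (length xs) (App f ts)"
      using f ys by (auto simp: tuples_def)
    then show "fint \<M> f ys \<in> ?T" by blast
  qed
  moreover have "set xs \<subseteq> ?T"
  proof
    fix x assume "x \<in> set xs"
    then obtain i where "i < length xs" "x = eval_trm \<M> xs (Var i)" by (auto simp: in_set_conv_nth)
    then show "x \<in> ?T" by (intro image_eqI[of _ _ "Var i"]) auto
  qed
  moreover have "?T \<subseteq> univ \<M>"
    using assms wf_eval_trm_in_closed[of L \<M> "univ \<M>" xs] by (auto simp: is_struct_def)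
  ultimately show "univ (generated L \<M> (set xs)) \<subseteq> ?T" by (intro univ_generated_subset)
  show "?T \<subseteq> univ (generated L \<M> (set xs))"
    using wf_eval_trm_in_closed[OF closed_under_generated subset_univ_generated] by blast
qed

text \<open>The map sends t(xs) to t(ys) for every term t. Equal types contain the same equations,
  which makes it well defined and injective, and the same relational formulas.\<close>

lemma qftp_eq_extends_to_generated:
  assumes M: "is_struct L \<M>" and xs: "set xs \<subseteq> univ \<M>" and ys: "set ys \<subseteq> univ \<M>"
    and len: "length xs = length ys" and tp: "qftp L \<M> xs = qftp L \<M> ys"
  obtains h where "h \<in> embeddings L (generated L \<M> (set xs)) (generated L \<M> (set ys))"
    and "map h xs = ys"
proof -
  let ?X = "generated L \<M> (set xs)" and ?Y = "generated L \<M> (set ys)"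
  let ?W = "{t. wf_trm L (length xs) t}"
  have X: "univ ?X = eval_trm \<M> xs ` ?W" and Y: "univ ?Y = eval_trm \<M> ys ` ?W"
    using univ_generated_eq_eval_trm[OF M] xs ys len by simp_all
  have eq: "eval_trm \<M> xs s = eval_trm \<M> xs t \<longleftrightarrow> eval_trm \<M> ys s = eval_trm \<M> ys t"
    if "s \<in> ?W" "t \<in> ?W" for s t
    using qftp_eq_eval_trm_eq_iff[OF tp len] that by simp
  \<comment> \<open>\<open>SOME\<close> picks a term naming \<open>x\<close>; by \<open>eq\<close>
    the value at \<open>ys\<close> does not depend on the pick.\<close>
  define h where
    "h = restrict (\<lambda>x. eval_trm \<M> ys (SOME t. t \<in> ?W \<and> eval_trm \<M> xs t = x)) (univ ?X)"
  have h: "h (eval_trm \<M> xs t) = eval_trm \<M> ys t" if t: "t \<in> ?W" for t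
  proof -
    let ?s = "SOME s. s \<in> ?W \<and> eval_trm \<M> xs s = eval_trm \<M> xs t"
    have "?s \<in> ?W \<and> eval_trm \<M> xs ?s = eval_trm \<M> xs t"
      by (rule someI[of _ t]) (use t in simp)
    then have "eval_trm \<M> ys ?s = eval_trm \<M> ys t" using eq[of ?s t] t by blast
    then show ?thesis using t X by (simp add: h_def)
  qed
  \<comment> \<open>Naming tuples entrywise by terms reduces preservation of symbols to evaluating
    terms at \<open>xs\<close> and at \<open>ys\<close>.\<close>
  have terms: "\<exists>ts. set ts \<subseteq> ?W \<and> zs = map (eval_trm \<M> xs) ts" if "set zs \<subseteq> univ ?X" for zs
  proof -
    have "zs \<in> map (eval_trm \<M> xs) ` lists ?W"
      using that unfolding X by (subst lists_image[symmetric]) (simp add: lists_eq_set)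
    then show ?thesis unfolding lists_eq_set by blast
  qed
  have hmap: "map h (map (eval_trm \<M> xs) ts) = map (eval_trm \<M> ys) ts" if "set ts \<subseteq> ?W" for ts
    using that h by auto
  have "h \<in> embeddings L ?X ?Y"
    unfolding embeddings_def
  proof (intro CollectI conjI ballI)
    show "h \<in> univ ?X \<rightarrow>\<^sub>E univ ?Y"
    proof (rule PiE_I)
      fix x assume "x \<in> univ ?X"
      then show "h x \<in> univ ?Y" unfolding X Y using h by auto
    qed (simp add: h_def)
    show "inj_on h (univ ?X)"
      unfolding X using h eq by (auto intro!: inj_onI)
    show "h (fint ?X f zs) = fint ?Y f (map h zs)"
      if f: "f \<in> funs L" and zs: "zs \<in> tuples (univ ?X) (farity L f)" for f zs
    proof -
      obtain ts where ts: "set ts \<subseteq> ?W" "zs = map (eval_trm \<M> xs) ts"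
        using zs terms by (auto simp: tuples_def)
      then have "App f ts \<in> ?W" using f zs by (auto simp: tuples_def)
      from h[OF this] show ?thesis using hmap[OF ts(1)] by (simp add: ts(2) del: map_map)
    qed
    show "rint ?X r zs \<longleftrightarrow> rint ?Y r (map h zs)"
      if r: "r \<in> rels L" and zs: "zs \<in> tuples (univ ?X) (rarity L r)" for r zs
    proof -
      obtain ts where ts: "set ts \<subseteq> ?W" "zs = map (eval_trm \<M> xs) ts"
        using zs terms by (auto simp: tuples_def)
      then have "length ts = rarity L r" using zs by (simp add: tuples_def)
      then show ?thesis
        using qftp_eq_rint_iff[OF tp len r, of ts] ts hmap[OF ts(1)]
        by (auto simp del: map_map)
    qed
  qed
  moreover have "map h xs = ys"
  proof (rule nth_equalityI)
    fix i assume "i < length (map h xs)"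
    then show "map h xs ! i = ys ! i" using h[of "Var i"] by simp
  qed (simp add: len)
  ultimately show thesis by (rule that)
qed

section \<open>Transfer of the embedding Ramsey property\<close>

text \<open>Since \<open>f\<close> and \<open>\<gamma>\<close> preserve types, \<beta>(xs) and
  \<gamma>(f(\<beta>(xs))) have the same type in \<open>\<M>1\<close>, hence by \<open>types\<close>
  in \<open>\<M>2\<close>, where \<open>\<beta>\<close> identifies it with the type of
  \<open>xs\<close> in \<open>A\<close>.\<close>

lemma embeddings_transfer:
  assumes A: "is_struct L2 A" and C: "is_struct L1 C"
    and \<beta>: "\<beta> \<in> embeddings L2 A \<M>2" and \<gamma>: "\<gamma> \<in> embeddings L1 C \<M>1"
    and univs: "univ \<M>1 = M" "univ \<M>2 = M"
    and types: "\<And>a b. set a \<subseteq> M \<Longrightarrow> set b \<subseteq> M \<Longrightarrow> length a = length b \<Longrightarrow>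
           qftp L1 \<M>1 a = qftp L1 \<M>1 b \<Longrightarrow> qftp L2 \<M>2 a = qftp L2 \<M>2 b"
    and f: "f \<in> embeddings L1 (generated L1 \<M>1 (\<beta> ` univ A)) C"
  shows "(\<lambda>x\<in>univ A. \<gamma> (f (\<beta> x))) \<in> embeddings L2 A (generated L2 \<M>2 (\<gamma> ` univ C))"
  unfolding embeddings_iff_qftp[OF A]
proof (intro conjI allI impI)
  let ?A1 = "generated L1 \<M>1 (\<beta> ` univ A)" and ?g = "\<lambda>x\<in>univ A. \<gamma> (f (\<beta> x))"
  note \<beta>' = \<beta>[unfolded embeddings_iff_qftp[OF A]] and \<gamma>' = \<gamma>[unfolded embeddings_iff_qftp[OF C]]
    and f' = f[unfolded embeddings_iff_qftp[OF is_struct_generated]]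
  have in_A1: "\<beta> x \<in> univ ?A1" if "x \<in> univ A" for x
    using that subset_univ_generated[of "\<beta> ` univ A"] by blast
  then have in_C: "f (\<beta> x) \<in> univ C" if "x \<in> univ A" for x using f' that by blast
  then show "?g \<in> univ A \<rightarrow>\<^sub>E univ (generated L2 \<M>2 (\<gamma> ` univ C))"
    using subset_univ_generated[of "\<gamma> ` univ C" L2 \<M>2] by auto
  fix xs assume xs: "set xs \<subseteq> univ A"
  then have bxs: "set (map \<beta> xs) \<subseteq> univ ?A1" and fxs: "set (map f (map \<beta> xs)) \<subseteq> univ C"
    using in_A1 in_C by auto
  have "map ?g xs = map \<gamma> (map f (map \<beta> xs))" using xs by auto
  moreover have "qftp L1 \<M>1 (map \<gamma> (map f (map \<beta> xs))) = qftp L1 C (map f (map \<beta> xs))"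
    using \<gamma>' fxs by (simp del: map_map)
  moreover have "qftp L1 C (map f (map \<beta> xs)) = qftp L1 \<M>1 (map \<beta> xs)"
    using f' bxs by (simp del: map_map)
  moreover have "set (map \<beta> xs) \<subseteq> M" using \<beta>' xs univs by auto
  moreover have "set (map \<gamma> (map f (map \<beta> xs))) \<subseteq> M" using \<gamma>' fxs univs by auto
  ultimately have "qftp L2 \<M>2 (map ?g xs) = qftp L2 \<M>2 (map \<beta> xs)"
    by (metis length_map types)
  then show "qftp L2 (generated L2 \<M>2 (\<gamma> ` univ C)) (map ?g xs) = qftp L2 A xs"
    using \<beta>' xs by simp
qed

text \<open>In \<open>\<M>1\<close> the copy of \<open>A\<close> may generate further points, to
  which \<open>f\<close>, carried along \<open>\<beta>\<close>, must be extended. A tuple listing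
  the copy and its image have equal types in \<open>\<M>2\<close>, hence in \<open>\<M>1\<close>, so
  the map on term values does this.\<close>

lemma embeddings_lift:
  assumes \<M>1: "is_struct L1 \<M>1" and A: "is_struct L2 A" and B: "is_struct L2 B"
    and AB: "substructure L2 A B" and fin: "finite (univ A)"
    and \<beta>: "\<beta> \<in> embeddings L2 B \<M>2" and f: "f \<in> embeddings L2 A B"
    and univs: "univ \<M>1 = M" "univ \<M>2 = M"
    and types: "\<And>a b. set a \<subseteq> M \<Longrightarrow> set b \<subseteq> M \<Longrightarrow> length a = length b \<Longrightarrow>
           qftp L2 \<M>2 a = qftp L2 \<M>2 b \<Longrightarrow> qftp L1 \<M>1 a = qftp L1 \<M>1 b"
  obtains h where
    "h \<in> embeddings L1 (generated L1 \<M>1 (\<beta> ` univ A)) (generated L1 \<M>1 (\<beta> ` univ B))"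
    and "\<And>x. x \<in> univ A \<Longrightarrow> h (\<beta> x) = \<beta> (f x)"
proof -
  \<comment> \<open>Finiteness lets a single tuple list \<open>A\<close>, so that one type controls
    the whole structure.\<close>
  obtain xs where xs: "set xs = univ A" using fin finite_list by blast
  let ?as = "map \<beta> xs" and ?bs = "map \<beta> (map f xs)"
  note \<beta>' = \<beta>[unfolded embeddings_iff_qftp[OF B]] and f' = f[unfolded embeddings_iff_qftp[OF A]]
  have sub: "set xs \<subseteq> univ B" using AB xs by (simp add: substructure_def)
  have fxs: "set (map f xs) \<subseteq> univ B" using f' xs by auto
  \<comment> \<open>Both equal the type of \<open>map \<beta> xs\<close> in \<open>\<M>2\<close>,
    since \<open>\<beta>\<close> and its restriction to \<open>A\<close> are embeddings.\<close>
  have "qftp L2 A xs = qftp L2 B xs"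
    using embeddings_subset_substructure[OF AB \<beta>] \<beta>' sub xs
    by (metis (no_types, lifting) A embeddings_iff_qftp map_cong order_refl restrict_apply')
  then have "qftp L2 \<M>2 ?as = qftp L2 \<M>2 ?bs"
    using \<beta>' f' sub fxs xs by (simp del: map_map)
  moreover have M: "set ?as \<subseteq> M" "set ?bs \<subseteq> M" using \<beta>' sub fxs univs by auto
  ultimately have "qftp L1 \<M>1 ?as = qftp L1 \<M>1 ?bs" by (intro types) auto
  then obtain h where
    h: "h \<in> embeddings L1 (generated L1 \<M>1 (set ?as)) (generated L1 \<M>1 (set ?bs))" "map h ?as = ?bs"
    using qftp_eq_extends_to_generated[OF \<M>1, of ?as ?bs] M univs by auto
  \<comment> \<open>The target of \<open>h\<close> is generated by \<open>?bs\<close> alone; it is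
    enlarged to the structure generated by the whole copy of \<open>B\<close>, with the same
    interpretations.\<close>
  have "set ?bs \<subseteq> \<beta> ` univ B" using fxs by auto
  from univ_generated_mono[OF this, of L1 \<M>1]
  have "h \<in> embeddings L1 (generated L1 \<M>1 (\<beta> ` univ A)) (generated L1 \<M>1 (\<beta> ` univ B))"
    using h(1) xs by (auto simp: embeddings_def PiE_iff image_image subset_iff)
  moreover have "h (\<beta> x) = \<beta> (f x)" if "x \<in> univ A" for x using h(2) xs that by auto
  ultimately show thesis by (rule that)
qed

lemma embedding_Ramsey_transfer:
  assumes \<M>1: "is_struct L1 \<M>1" and \<M>2: "is_struct L2 \<M>2"
    and univs: "univ \<M>1 = M" "univ \<M>2 = M"
    and lf1: "locally_finite L1 \<M>1" and lf2: "locally_finite L2 \<M>2"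
    and types: "\<And>a b. set a \<subseteq> M \<Longrightarrow> set b \<subseteq> M \<Longrightarrow> length a = length b \<Longrightarrow>
           qftp L1 \<M>1 a = qftp L1 \<M>1 b \<longleftrightarrow> qftp L2 \<M>2 a = qftp L2 \<M>2 b"
    and Ramsey: "embedding_Ramsey L1 \<M>1"
  shows "embedding_Ramsey L2 \<M>2"
  unfolding embedding_Ramsey_def
proof (intro ballI impI)
  fix A B assume "A \<in> Age L2 \<M>2" "B \<in> Age L2 \<M>2" and AB: "substructure L2 A B"
  \<comment> \<open>The one embedding \<open>\<beta>\<close> of \<open>B\<close> realises
    \<open>A\<close> as well, compatibly with the inclusion.\<close>
  then obtain \<beta> where A: "is_struct L2 A" "finite (univ A)" and B: "is_struct L2 B" "finite (univ B)"
    and \<beta>: "\<beta> \<in> embeddings L2 B \<M>2"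
    using locally_finite_Age[OF lf2] by metis
  let ?A1 = "generated L1 \<M>1 (\<beta> ` univ A)" and ?B1 = "generated L1 \<M>1 (\<beta> ` univ B)"
  have sub: "univ A \<subseteq> univ B" using AB by (simp add: substructure_def)
  have "\<beta> ` univ B \<subseteq> univ \<M>1" using \<beta> univs by (auto simp: embeddings_def)
  moreover from this sub have "\<beta> ` univ A \<subseteq> univ \<M>1" by blast
  ultimately have "?A1 \<in> Age L1 \<M>1" "?B1 \<in> Age L1 \<M>1"
    using A B generated_in_Age[OF \<M>1] by simp_all
  moreover have "substructure L1 ?A1 ?B1" using sub by (intro substructure_generated_mono) auto
  ultimately obtain C where C: "C \<in> Age L1 \<M>1" and arr: "arrows L1 C ?B1 ?A1"
    using Ramsey unfolding embedding_Ramsey_def by blast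
  obtain \<gamma> where Cs: "is_struct L1 C" "finite (univ C)" and \<gamma>: "\<gamma> \<in> embeddings L1 C \<M>1"
    using locally_finite_Age[OF lf1 C] .
  let ?C2 = "generated L2 \<M>2 (\<gamma> ` univ C)"
  have "\<gamma> ` univ C \<subseteq> univ \<M>2" using \<gamma> univs by (auto simp: embeddings_def)
  then have "?C2 \<in> Age L2 \<M>2" using Cs generated_in_Age[OF \<M>2] by simp
  moreover have "arrows L2 ?C2 B A"
    unfolding arrows_def
  proof
    fix \<chi> :: "_ \<Rightarrow> nat" assume \<chi>: "\<chi> \<in> embeddings L2 A ?C2 \<rightarrow> {0, 1}"
    \<comment> \<open>An embedding of \<open>?A1\<close> into \<open>C\<close> gets the colour of
      the embedding of \<open>A\<close> into \<open>?C2\<close> that it induces along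
      \<open>\<beta>\<close> and \<open>\<gamma>\<close>.\<close>
    let ?\<chi>' = "\<lambda>g. \<chi> (\<lambda>x\<in>univ A. \<gamma> (g (\<beta> x)))"
    have \<beta>A: "restrict \<beta> (univ A) \<in> embeddings L2 A \<M>2"
      using embeddings_subset_substructure[OF AB \<beta>] .
    have "(\<lambda>x\<in>univ A. \<gamma> (g (\<beta> x))) \<in> embeddings L2 A ?C2" if "g \<in> embeddings L1 ?A1 C" for g
    proof -
      \<comment> \<open>Embeddings of \<open>A\<close> are extensional, so \<open>\<beta>\<close>
        enters restricted to \<open>univ A\<close>; its image, and with it \<open>?A1\<close>, is
        unchanged.\<close>
      have "restrict \<beta> (univ A) ` univ A = \<beta> ` univ A" by auto
      then have "(\<lambda>x\<in>univ A. \<gamma> (g (restrict \<beta> (univ A) x))) \<in> embeddings L2 A ?C2"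
        using embeddings_transfer[OF A(1) Cs(1) \<beta>A \<gamma> univs, of g] types that by simp
      then show ?thesis by (simp cong: restrict_cong)
    qed
    then have "?\<chi>' \<in> embeddings L1 ?A1 C \<rightarrow> {0, 1}" using \<chi> by blast
    from bspec[OF arr[unfolded arrows_def] this]
    obtain e c where e: "e \<in> embeddings L1 ?B1 C"
      and "\<forall>g\<in>{compose (univ ?A1) e f |f. f \<in> embeddings L1 ?A1 ?B1}. ?\<chi>' g = c"
      by blast
    then have c: "?\<chi>' (compose (univ ?A1) e f) = c" if "f \<in> embeddings L1 ?A1 ?B1" for f
      using that by blast
    let ?e = "\<lambda>x\<in>univ B. \<gamma> (e (\<beta> x))"
    have "?e \<in> embeddings L2 B ?C2"
      using embeddings_transfer[OF B(1) Cs(1) \<beta> \<gamma> univs _ e] types by simp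
    moreover have "\<chi> (compose (univ A) ?e f) = c" if f: "f \<in> embeddings L2 A B" for f
    proof -
      obtain h where h: "h \<in> embeddings L1 ?A1 ?B1" "\<And>x. x \<in> univ A \<Longrightarrow> h (\<beta> x) = \<beta> (f x)"
        using embeddings_lift[OF \<M>1 A(1) B(1) AB A(2) \<beta> f univs] types by metis
      have "f x \<in> univ B" if "x \<in> univ A" for x using f that by (auto simp: embeddings_def)
      moreover have "\<beta> x \<in> univ ?A1" if "x \<in> univ A" for x
        using that subset_univ_generated[of "\<beta> ` univ A"] by blast
      \<comment> \<open>Since \<open>h\<close> extends \<open>f\<close> along
        \<open>\<beta>\<close>, the composite of \<open>?e\<close> with \<open>f\<close> is the map
        induced by the composite of \<open>e\<close> with \<open>h\<close>, whose
        \<open>?\<chi>'\<close>-colour is \<open>c\<close>.\<close>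
      ultimately have
        "compose (univ A) ?e f = (\<lambda>x\<in>univ A. \<gamma> (compose (univ ?A1) e h (\<beta> x)))"
        using h(2) by (auto simp: compose_def fun_eq_iff)
      then show ?thesis using c[OF h(1)] by simp
    qed
    ultimately show "\<exists>e\<in>embeddings L2 B ?C2. \<exists>c.
        \<forall>g\<in>{compose (univ A) e f |f. f \<in> embeddings L2 A B}. \<chi> g = c"
      by blast
  qed
  ultimately show "\<exists>C\<in>Age L2 \<M>2. arrows L2 C B A" by blast
qed

theorem lemma6p2:
  fixes L1 :: "('f1, 'r1) lang" and L2 :: "('f2, 'r2) lang"
    and \<M>1 :: "('f1, 'r1, 'a) struct" and \<M>2 :: "('f2, 'r2, 'a) struct"
    and M :: "'a set"
  assumes "is_struct L1 \<M>1" and "is_struct L2 \<M>2"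
    and "univ \<M>1 = M" and "univ \<M>2 = M"
    and "locally_finite L1 \<M>1" and "locally_finite L2 \<M>2"
    and "\<And>a b. set a \<subseteq> M \<Longrightarrow> set b \<subseteq> M \<Longrightarrow> length a = length b \<Longrightarrow>
           qftp L1 \<M>1 a = qftp L1 \<M>1 b \<longleftrightarrow> qftp L2 \<M>2 a = qftp L2 \<M>2 b"
  shows "embedding_Ramsey L1 \<M>1 \<longleftrightarrow> embedding_Ramsey L2 \<M>2"
proof
  show "embedding_Ramsey L2 \<M>2" if "embedding_Ramsey L1 \<M>1"
    by (rule embedding_Ramsey_transfer[OF assms that])
  show "embedding_Ramsey L1 \<M>1" if "embedding_Ramsey L2 \<M>2"
    using embedding_Ramsey_transfer[OF assms(2,1,4,3,6,5) _ that] assms(7) by simp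
qed

end
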